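(* Let $n\ge 1$, let $S_n=K_{1,n}$ be the star with $n+1$ vertices, and let $H$ be any dispersable bipartite graph. Then $S_n+_Q H$ is dispersable, i.e. $\operatorname{mbt}(S_n+_Q H)=\Delta(S_n+_Q H)$.
   Context: Matching book embedding: the vertices are placed in a linear order along a spine and each edge is assigned to a page (half-plane bounded by the spine) so that no two edges on the same page cross and every vertex is incident with at most one edge on each page. $\operatorname{mbt}(G)$ is the minimum number of pages of a matching book embedding of $G$. $G$ is dispersable if $\operatorname{mbt}(G)=\Delta(G)$, where $\Delta$ denotes maximum degree. For a graph $G$, $Q(G)$ is obtained by inserting a new vertex into each edge of $G$ and then joining two new vertices whenever their edges of $G$ share an endpoint; thus $V(Q(G))=V(G)\cup E(G)$. The $Q$-sum $G+_Q H$ has vertex set $(V(G)\cup E(G))\times V(H)$. Two vertices $(u_1,u_2)$ and $(v_1,v_2)$ are adjacent if and only if either $u_1=v_1\in V(G)$ and $u_2v_2\in E(H)$, or $u_2=v_2$ and $u_1v_1\in E(Q(G))$. *)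

theory Defs
  imports Main
begin

datatype 'a graph = Graph (verts: "'a set") (edges: "'a set set")

definition fin_simple_graph :: "'a graph \<Rightarrow> bool" where
  "fin_simple_graph G \<longleftrightarrow> finite (verts G) \<and> (\<forall>e\<in>edges G. e \<subseteq> verts G \<and> card e = 2)"

definition bipartite :: "'a graph \<Rightarrow> bool" where
  "bipartite G \<longleftrightarrow> (\<exists>A B. A \<union> B = verts G \<and> A \<inter> B = {} \<and>
     (\<forall>e\<in>edges G. \<exists>a\<in>A. \<exists>b\<in>B. e = {a, b}))"

definition degree :: "'a graph \<Rightarrow> 'a \<Rightarrow> nat" where
  "degree G v = card {e \<in> edges G. v \<in> e}"

text \<open>The \<open>insert 0\<close> only matters for the graph without vertices, whose maximum degree is \<open>0\<close>.\<close>

definition max_degree :: "'a graph \<Rightarrow> nat" where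
  "max_degree G = Max (insert 0 (degree G ` verts G))"

text \<open>The order of the vertices along the spine is given by distinct positions \<open>pos\<close>. Two edges
  drawn in the same half-plane cross iff their endpoints strictly interleave on the spine.\<close>

definition crossing :: "('a \<Rightarrow> nat) \<Rightarrow> 'a set \<Rightarrow> 'a set \<Rightarrow> bool" where
  "crossing pos e f \<longleftrightarrow> (\<exists>a b c d. (e = {a, b} \<and> f = {c, d} \<or> e = {c, d} \<and> f = {a, b}) \<and>
     pos a < pos c \<and> pos c < pos b \<and> pos b < pos d)"

definition matching_book_embedding ::
  "'a graph \<Rightarrow> nat \<Rightarrow> ('a \<Rightarrow> nat) \<Rightarrow> ('a set \<Rightarrow> nat) \<Rightarrow> bool" where
  "matching_book_embedding G k pos page \<longleftrightarrow>
     inj_on pos (verts G) \<and>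
     (\<forall>e\<in>edges G. page e < k) \<and>
     (\<forall>e\<in>edges G. \<forall>f\<in>edges G. e \<noteq> f \<and> page e = page f \<longrightarrow> \<not> crossing pos e f) \<and>
     (\<forall>v\<in>verts G. \<forall>e\<in>edges G. \<forall>f\<in>edges G.
        v \<in> e \<and> v \<in> f \<and> page e = page f \<longrightarrow> e = f)"

definition mbt :: "'a graph \<Rightarrow> nat" where
  "mbt G = (LEAST k. \<exists>pos page. matching_book_embedding G k pos page)"

definition dispersable :: "'a graph \<Rightarrow> bool" where
  "dispersable G \<longleftrightarrow> mbt G = max_degree G"

text \<open>In \<open>Q(G)\<close>, \<open>Inl v\<close> is an original vertex and \<open>Inr e\<close> is the vertex inserted into the edge \<open>e\<close>.\<close>

definition Q_graph :: "'a graph \<Rightarrow> ('a + 'a set) graph" where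
  "Q_graph G = Graph (verts G <+> edges G)
     ({{Inl v, Inr e} | v e. e \<in> edges G \<and> v \<in> e} \<union>
      {{Inr e, Inr f} | e f. e \<in> edges G \<and> f \<in> edges G \<and> e \<noteq> f \<and> e \<inter> f \<noteq> {}})"

definition Q_sum :: "'a graph \<Rightarrow> 'b graph \<Rightarrow> (('a + 'a set) \<times> 'b) graph" where
  "Q_sum G H = Graph ((verts G <+> edges G) \<times> verts H)
     {{(u1, u2), (v1, v2)} | u1 u2 v1 v2.
        (u1 = v1 \<and> u1 \<in> Inl ` verts G \<and> {u2, v2} \<in> edges H) \<or>
        (u2 = v2 \<and> u2 \<in> verts H \<and> {u1, v1} \<in> edges (Q_graph G))}"

definition star :: "nat \<Rightarrow> nat graph" where
  "star n = Graph {0..n} {{0, i} | i. i \<in> {1..n}}"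

lemma fin_simple_graph_star: "fin_simple_graph (star n)"
  by (auto simp: fin_simple_graph_def star_def)

lemma finite_edges:
  assumes "fin_simple_graph G"
  shows "finite (edges G)"
  using assms by (auto simp: fin_simple_graph_def intro: finite_subset[of _ "Pow (verts G)"])

lemma fin_simple_graph_Q_graph:
  assumes "fin_simple_graph G"
  shows "fin_simple_graph (Q_graph G)"
proof -
  have "finite (verts (Q_graph G))"
    using assms finite_edges[OF assms] by (simp add: fin_simple_graph_def Q_graph_def)
  moreover have "e \<subseteq> verts (Q_graph G) \<and> card e = 2" if "e \<in> edges (Q_graph G)" for e
  proof -
    from that consider
        v f where "e = {Inl v, Inr f}" "f \<in> edges G" "v \<in> f"
      | f g where "e = {Inr f, Inr g}" "f \<in> edges G" "g \<in> edges G" "f \<noteq> g"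
      unfolding Q_graph_def graph.sel by blast
    then show ?thesis
    proof cases
      case 1
      then have "v \<in> verts G" using assms unfolding fin_simple_graph_def by blast
      with 1 show ?thesis by (simp add: Q_graph_def InlI InrI)
    qed (simp add: Q_graph_def InrI)
  qed
  ultimately show ?thesis by (simp add: fin_simple_graph_def)
qed

lemma fin_simple_graph_Q_sum:
  assumes G: "fin_simple_graph G" and H: "fin_simple_graph H"
  shows "fin_simple_graph (Q_sum G H)"
proof -
  have Q: "{u, v} \<in> edges (Q_graph G) \<Longrightarrow> u \<noteq> v \<and> u \<in> verts G <+> edges G \<and> v \<in> verts G <+> edges G"
    for u v
  proof -
    assume "{u, v} \<in> edges (Q_graph G)"
    then have "{u, v} \<subseteq> verts (Q_graph G)" "card {u, v} = 2"
      using fin_simple_graph_Q_graph[OF G] unfolding fin_simple_graph_def by blast+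
    then show ?thesis by (cases "u = v") (simp_all add: Q_graph_def)
  qed
  have E: "{u, v} \<in> edges H \<Longrightarrow> u \<noteq> v \<and> u \<in> verts H \<and> v \<in> verts H" for u v
  proof -
    assume "{u, v} \<in> edges H"
    then have "{u, v} \<subseteq> verts H" "card {u, v} = 2"
      using H unfolding fin_simple_graph_def by blast+
    then show ?thesis by (cases "u = v") simp_all
  qed
  have "finite (verts (Q_sum G H))"
    using G H finite_edges[OF G] by (simp add: fin_simple_graph_def Q_sum_def)
  moreover have "e \<subseteq> verts (Q_sum G H) \<and> card e = 2" if eQ: "e \<in> edges (Q_sum G H)" for e
  proof -
    obtain u1 u2 v1 v2 where e: "e = {(u1, u2), (v1, v2)}" and
      "(u1 = v1 \<and> u1 \<in> Inl ` verts G \<and> {u2, v2} \<in> edges H) \<or>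
        (u2 = v2 \<and> u2 \<in> verts H \<and> {u1, v1} \<in> edges (Q_graph G))"
      using eQ unfolding Q_sum_def graph.sel mem_Collect_eq by blast
    then have "(u1, u2) \<noteq> (v1, v2) \<and> (u1, u2) \<in> verts (Q_sum G H) \<and> (v1, v2) \<in> verts (Q_sum G H)"
      using Q[of u1 v1] E[of u2 v2] unfolding Q_sum_def by auto
    then show ?thesis by (simp add: e)
  qed
  ultimately show ?thesis by (simp add: fin_simple_graph_def)
qed

text \<open>The minimum in \<open>mbt\<close> is attained: giving every edge its own page is always possible.\<close>

lemma mbt_attained:
  assumes "fin_simple_graph G"
  shows "\<exists>pos page. matching_book_embedding G (mbt G) pos page"
proof -
  obtain pos :: "'a \<Rightarrow> nat" where pos: "inj_on pos (verts G)"
    using assms finite_imp_inj_to_nat_seg unfolding fin_simple_graph_def by metis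
  obtain page :: "'a set \<Rightarrow> nat" and m where page: "inj_on page (edges G)" "page ` edges G = {i. i < m}"
    using finite_imp_inj_to_nat_seg[OF finite_edges[OF assms]] by metis
  have "matching_book_embedding G m pos page"
    unfolding matching_book_embedding_def
  proof (intro conjI)
    show "\<forall>e\<in>edges G. page e < m" using page(2) by blast
  qed (use pos page(1) in \<open>blast dest: inj_onD\<close>)+
  then have "\<exists>pos page. matching_book_embedding G m pos page" by blast
  then show ?thesis unfolding mbt_def by (rule LeastI)
qed

end

theory Submission
  imports Defs
begin

text \<open>
  In \<open>Q(S\<^sub>n)\<close> the centre and the \<open>n\<close> subdivision vertices form a clique, and every leaf hangs on its
  subdivision vertex. Number the clique \<open>0, \<dots>, n\<close> with the centre first, put leaf \<open>i\<close> immediately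
  after the clique vertex \<open>i\<close>, and colour the edge between \<open>i\<close> and \<open>j\<close> by \<open>i + j\<close> modulo \<open>n + 1\<close>, the
  pendant edge at \<open>i\<close> receiving the one colour \<open>2i\<close> missing there. Edges of one colour \<open>q\<close> form parallel
  chords, none of which passes over the gap between \<open>q\<close> and \<open>q + 1\<close>, where leaf \<open>q\<close> sits.
  Now replace each vertex of \<open>H\<close>, in the spine order of an optimal embedding, by such a block, reversed
  for one of the two colour classes of \<open>H\<close>, so that all copies of an edge of \<open>H\<close> are nested. The edges
  of the first page of \<open>H\<close> in layer \<open>i\<close> go to page \<open>i\<close>, those of the other pages of \<open>H\<close> go to new pages
  shared by all layers. This takes \<open>n + max 1 \<Delta>(H)\<close> pages, and if \<open>H\<close> has a vertex, the copy of the
  centre or of a subdivision vertex above a vertex of maximum degree attains this degree.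
\<close>

section \<open>Degree bounds\<close>

lemma neighbours_le_degree:
  assumes "finite (edges G)" and "\<And>w. w \<in> N \<Longrightarrow> {v, w} \<in> edges G"
  shows "card N \<le> degree G v"
proof -
  have "inj_on (\<lambda>w. {v, w}) N"
    by (auto simp: inj_on_def doubleton_eq_iff)
  then show ?thesis
    unfolding degree_def by (rule card_inj_on_le) (use assms in auto)
qed

lemma degree_eq_neighbours:
  assumes "fin_simple_graph G"
  shows "degree G v = card {w. {v, w} \<in> edges G}"
proof -
  have "{e \<in> edges G. v \<in> e} = (\<lambda>w. {v, w}) ` {w. {v, w} \<in> edges G}"
  proof (intro equalityI subsetI)
    fix e assume e: "e \<in> {e \<in> edges G. v \<in> e}"
    then have "card e = 2"
      using assms by (auto simp: fin_simple_graph_def)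
    then obtain x y where "e = {x, y}"
      by (auto simp: card_2_iff)
    with e show "e \<in> (\<lambda>w. {v, w}) ` {w. {v, w} \<in> edges G}"
      by (auto simp: insert_commute)
  qed auto
  moreover have "inj_on (\<lambda>w. {v, w}) {w. {v, w} \<in> edges G}"
    by (auto simp: inj_on_def doubleton_eq_iff)
  ultimately show ?thesis
    unfolding degree_def by (simp add: card_image)
qed

lemma degree_le_max_degree:
  assumes "finite (verts G)" "v \<in> verts G"
  shows "degree G v \<le> max_degree G"
  unfolding max_degree_def by (rule Max_ge) (use assms in auto)

lemma max_degree_attained:
  assumes "finite (verts G)" "verts G \<noteq> {}"
  obtains v where "v \<in> verts G" "degree G v = max_degree G"
proof -
  have "max_degree G \<in> insert 0 (degree G ` verts G)"
    unfolding max_degree_def by (rule Max_in) (use assms in auto)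
  then show thesis
  proof
    assume "max_degree G = 0"
    then show thesis
      using that degree_le_max_degree[OF assms(1)] assms(2) by fastforce
  qed (use that in auto)
qed

text \<open>The edges at one vertex lie on pairwise distinct pages.\<close>

lemma max_degree_le_pages:
  assumes "fin_simple_graph G" "matching_book_embedding G k pos page"
  shows "max_degree G \<le> k"
proof -
  have "degree G v \<le> k" if "v \<in> verts G" for v
  proof -
    have "inj_on page {e \<in> edges G. v \<in> e}"
      using assms(2) that unfolding matching_book_embedding_def inj_on_def by blast
    moreover have "page ` {e \<in> edges G. v \<in> e} \<subseteq> {..<k}"
      using assms(2) unfolding matching_book_embedding_def by blast
    ultimately show ?thesis
      unfolding degree_def using card_inj_on_le[of page _ "{..<k}"] by simp
  qed
  then show ?thesis
    using assms(1) by (simp add: max_degree_def fin_simple_graph_def)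
qed

lemma dispersableI:
  assumes "fin_simple_graph G" "matching_book_embedding G k pos page" "k \<le> max_degree G"
  shows "dispersable G"
proof -
  have "mbt G \<le> k"
    unfolding mbt_def by (rule Least_le) (use assms(2) in blast)
  moreover have "max_degree G \<le> mbt G"
    using mbt_attained[OF assms(1)] max_degree_le_pages[OF assms(1)] by blast
  ultimately show ?thesis
    using assms(3) by (simp add: dispersable_def)
qed

section \<open>The layout of a single block\<close>

text \<open>The clique vertex \<open>i\<close> has level \<open>2i\<close>, the leaf \<open>i\<close> has level \<open>2i + 1\<close>. The vertex \<open>Inr {0, i}\<close> has
  number \<open>i\<close>, which is \<open>\<Sum>{0, i}\<close>.\<close>

definition level :: "nat + nat set \<Rightarrow> nat" where
  "level x = (case x of Inl i \<Rightarrow> if i = 0 then 0 else 2 * i + 1 | Inr e \<Rightarrow> 2 * \<Sum>e)"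

text \<open>Adjacency in \<open>Q_graph (star n)\<close> seen on levels: even levels form the
  clique, and an odd level hangs on its predecessor. The guards \<open>0 < x\<close> and
  \<open>0 < y\<close> keep level 1 isolated, since the centre carries no leaf.\<close>

definition level_edge :: "nat \<Rightarrow> nat \<Rightarrow> nat \<Rightarrow> bool" where
  "level_edge n x y \<longleftrightarrow> x \<le> 2 * n + 1 \<and> y \<le> 2 * n + 1 \<and>
     (even x \<and> even y \<and> x \<noteq> y \<or> even x \<and> 0 < x \<and> y = Suc x \<or> even y \<and> 0 < y \<and> x = Suc y)"

definition level_page :: "nat \<Rightarrow> nat \<Rightarrow> nat \<Rightarrow> nat" where
  "level_page n x y = (x div 2 + y div 2) mod (n + 1)"

lemma level_edge_commute: "level_edge n x y = level_edge n y x"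
  by (auto simp: level_edge_def)

lemma level_page_commute: "level_page n x y = level_page n y x"
  by (simp add: level_page_def add.commute)

section \<open>Arithmetic of the colouring modulo \<open>n + 1\<close>\<close>

lemma mod_eq_imp_eq:
  fixes a b m :: nat
  assumes "a mod m = b mod m" "a \<le> b" "b < a + m"
  shows "a = b"
proof (rule ccontr)
  assume "a \<noteq> b"
  moreover have "m dvd b - a"
    using assms(1,2) by (metis mod_eq_dvd_iff_nat)
  ultimately show False
    using assms(2,3) by (auto dest!: dvd_imp_le)
qed

text \<open>Pendant edges join consecutive levels and cannot interleave with anything, so both edges
  lie in the clique, with numbers a < b < c < d. Then a + c < b + d, and b < c and d \<le> n keep
  the difference below the modulus.\<close>

lemma level_edges_no_crossing:
  assumes "level_edge n x z" "level_edge n y w" "level_page n x z = level_page n y w"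
    and "x < y" "y < z" "z < w"
  shows False
proof -
  have "even x" "even y" "even z" "even w" "w \<le> 2 * n + 1"
    using assms by (auto simp: level_edge_def)
  then obtain a b c d where "x = 2 * a" "y = 2 * b" "z = 2 * c" "w = 2 * d"
    by (auto elim!: evenE)
  then show False
    using assms(3-6) \<open>w \<le> 2 * n + 1\<close> mod_eq_imp_eq[of "a + c" "n + 1" "b + d"]
    by (auto simp: level_page_def)
qed

text \<open>Such an edge has clique ends a \<le> i < b \<le> n, hence i < a + b < i + (n + 1), which
  excludes colour i.\<close>

lemma level_edges_not_over_leaf:
  assumes "level_edge n x y" "level_page n x y = i" "x < 2 * i + 1" "2 * i + 1 < y"
  shows False
proof -
  have "even x" "even y" "y \<le> 2 * n + 1"
    using assms by (auto simp: level_edge_def)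
  then obtain a b where "x = 2 * a" "y = 2 * b"
    by (auto elim!: evenE)
  moreover have "i mod (n + 1) = i"
    using assms(2) by (auto simp: level_page_def)
  ultimately show False
    using assms(2-4) \<open>y \<le> 2 * n + 1\<close> mod_eq_imp_eq[of i "n + 1" "a + b"]
    by (auto simp: level_page_def)
qed

lemma level_edges_matching:
  assumes "level_edge n x y" "level_edge n x z" "level_page n x y = level_page n x z"
  shows "y = z"
proof -
  have *: "y div 2 = z div 2"
  proof (cases "y div 2 \<le> z div 2")
    case True
    then show ?thesis
      using assms mod_eq_imp_eq[of "x div 2 + y div 2" "n + 1" "x div 2 + z div 2"]
      by (auto simp: level_page_def level_edge_def)
  next
    case False
    then show ?thesis
      using assms mod_eq_imp_eq[of "x div 2 + z div 2" "n + 1" "x div 2 + y div 2"]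
      by (auto simp: level_page_def level_edge_def)
  qed
  \<comment> \<open>Equal halves leave only a clique vertex 2j and its leaf as distinct candidates.
    The leaf forces \<open>x\<close> to be 2j, which is not adjacent to itself.\<close>
  then show ?thesis
    using assms(1,2) unfolding level_edge_def by (elim disjE conjE evenE) auto
qed

text \<open>This keeps page i free at original vertex i for the first page of H. Colour i would
  require a neighbour of number 0, but leaf i sees only clique vertex i, and the centre is not its
  own neighbour.\<close>

lemma level_page_ne_layer:
  assumes "level_edge n (level (Inl i)) y" "i \<le> n"
  shows "level_page n (level (Inl i)) y \<noteq> i"
proof
  assume "level_page n (level (Inl i)) y = i"
  moreover have "level (Inl i) div 2 = i"
    by (simp add: level_def)
  ultimately have "i = i + y div 2"
    using assms mod_eq_imp_eq[of i "n + 1" "i + y div 2"]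
    by (auto simp: level_page_def level_edge_def)
  then show False
    using assms(1) by (auto simp: level_edge_def level_def split: if_splits)
qed

section \<open>Levels of the vertices and edges of \<open>Q_graph (star n)\<close>\<close>

lemma edges_star: "edges (star n) = (\<lambda>i. {0, i}) ` {1..n}"
  by (auto simp: star_def)

lemma verts_star: "verts (star n) = {0..n}"
  by (simp add: star_def)

lemma level_star_edge: "1 \<le> i \<Longrightarrow> level (Inr {0, i}) = 2 * i"
  by (simp add: level_def)

lemma level_leaf: "0 < i \<Longrightarrow> level (Inl i) = 2 * i + 1"
  by (simp add: level_def)

lemma level_centre: "level (Inl 0) = 0"
  by (simp add: level_def)

lemma star_vertex_cases:
  assumes "x \<in> verts (star n) <+> edges (star n)"
  obtains (centre) "x = Inl 0" "level x = 0"
    | (leaf) i where "1 \<le> i" "i \<le> n" "x = Inl i" "level x = 2 * i + 1"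
    | (mid) i where "1 \<le> i" "i \<le> n" "x = Inr {0, i}" "level x = 2 * i"
proof (cases x)
  case (Inl i)
  then show thesis
    using assms that(1,2) by (cases "i = 0") (auto simp: level_def verts_star)
next
  case (Inr e)
  then show thesis
    using assms that(3) by (auto simp: level_star_edge edges_star)
qed

lemma inj_on_level: "inj_on level (verts (star n) <+> edges (star n))"
proof (rule inj_onI)
  fix x y assume x: "x \<in> verts (star n) <+> edges (star n)"
    and y: "y \<in> verts (star n) <+> edges (star n)" and "level x = level y"
  then show "x = y"
    by (cases rule: star_vertex_cases[OF x]; cases rule: star_vertex_cases[OF y]; simp; presburger)
qed

lemma level_le: "x \<in> verts (star n) <+> edges (star n) \<Longrightarrow> level x \<le> 2 * n + 1"
  by (erule star_vertex_cases) auto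

lemma level_edge_Q_graph:
  assumes "{x, y} \<in> edges (Q_graph (star n))"
  shows "level_edge n (level x) (level y)"
proof -
  from assms consider
      v e where "{x, y} = {Inl v, Inr e}" "e \<in> edges (star n)" "v \<in> e"
    | e f where "{x, y} = {Inr e, Inr f}" "e \<in> edges (star n)" "f \<in> edges (star n)" "e \<noteq> f"
    unfolding Q_graph_def graph.sel by blast
  then show ?thesis
  proof cases
    case 1
    obtain i where i: "e = {0, i}" "1 \<le> i" "i \<le> n" "v = 0 \<or> v = i"
      using 1(2,3) by (auto simp: edges_star)
    then have "level_edge n (level (Inl v)) (level (Inr e))"
      by (auto simp: level_star_edge level_edge_def level_centre level_leaf)
    moreover have "x = Inl v \<and> y = Inr e \<or> x = Inr e \<and> y = Inl v"
      using 1(1) by (simp only: doubleton_eq_iff)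
    ultimately show ?thesis
      using level_edge_commute by metis
  next
    case 2
    obtain i j where "e = {0, i}" "1 \<le> i" "i \<le> n" "f = {0, j}" "1 \<le> j" "j \<le> n"
      using 2(2,3) by (auto simp: edges_star)
    with 2(4) have "level_edge n (level (Inr e)) (level (Inr f))"
      by (auto simp: level_star_edge level_edge_def)
    moreover have "x = Inr e \<and> y = Inr f \<or> x = Inr f \<and> y = Inr e"
      using 2(1) by (simp only: doubleton_eq_iff)
    ultimately show ?thesis
      using level_edge_commute by metis
  qed
qed

section \<open>The layout of the whole graph\<close>

locale bipartite_embedding =
  fixes n k :: nat and H :: "'b graph" and A B :: "'b set"
    and posH :: "'b \<Rightarrow> nat" and pageH :: "'b set \<Rightarrow> nat"
  assumes H: "fin_simple_graph H"
    and disjoint: "A \<inter> B = {}"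
    and bipartition: "\<And>e. e \<in> edges H \<Longrightarrow> \<exists>a\<in>A. \<exists>b\<in>B. e = {a, b}"
    and embedding: "matching_book_embedding H k posH pageH"
begin

text \<open>Each vertex of H owns a window of 2n + 2 positions, one for each level from 0 to 2n + 1;
  mirroring a block stays inside its window.\<close>

definition pos :: "(nat + nat set) \<times> 'b \<Rightarrow> nat" where
  "pos z = (2 * n + 2) * posH (snd z) +
     (if snd z \<in> A then level (fst z) else 2 * n + 1 - level (fst z))"

text \<open>Blocks use the colours 0 to n. Since a page p > 0 of H is shifted to n + p, the new
  pages start exactly at n + 1.\<close>

definition layer_page :: "nat \<Rightarrow> 'b set \<Rightarrow> nat" where
  "layer_page i f = (if pageH f = 0 then i else n + pageH f)"

text \<open>An edge inside a block has a single second component. For any other edge, \<open>Min\<close> picks the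
  common layer of its two endpoints.\<close>

definition page :: "((nat + nat set) \<times> 'b) set \<Rightarrow> nat" where
  "page e = (if card (snd ` e) = 1 then (\<Sum>z\<in>e. level (fst z) div 2) mod (n + 1)
     else layer_page (Min ((\<lambda>z. level (fst z) div 2) ` e)) (snd ` e))"

lemma H_edge:
  assumes "{a, b} \<in> edges H"
  shows "a \<noteq> b" "a \<in> verts H" "b \<in> verts H" "a \<in> A \<longleftrightarrow> b \<notin> A"
proof -
  have "{a, b} \<subseteq> verts H" "card {a, b} = 2"
    using H assms unfolding fin_simple_graph_def by blast+
  then show "a \<noteq> b" "a \<in> verts H" "b \<in> verts H"
    by (cases "a = b"; simp)+
  obtain x y where "x \<in> A" "y \<in> B" "{a, b} = {x, y}"
    using bipartition[OF assms] by blast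
  then show "a \<in> A \<longleftrightarrow> b \<notin> A"
    using disjoint by (auto simp only: doubleton_eq_iff)
qed

lemma page_inner:
  assumes "x \<noteq> y"
  shows "page {(x, v), (y, v)} = level_page n (level x) (level y)"
  using assms by (simp add: page_def level_page_def)

lemma page_outer:
  assumes "a \<noteq> b"
  shows "page {(Inl i, a), (Inl i, b)} = layer_page i {a, b}"
proof -
  have "level (Inl i) div 2 = i"
    by (simp add: level_def)
  then show ?thesis
    using assms by (simp add: page_def)
qed

text \<open>Both orientations of the unordered pair are absorbed here, so later case splits can
  speak of levels and layers with the ends already named.\<close>

lemma Q_sum_edge_cases:
  assumes "{z, w} \<in> edges (Q_sum (star n) H)"
  obtains (inner) "snd w = snd z" "level_edge n (level (fst z)) (level (fst w))"
      "page {z, w} = level_page n (level (fst z)) (level (fst w))"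
    | (outer) i where "i \<le> n" "fst z = Inl i" "fst w = Inl i" "{snd z, snd w} \<in> edges H"
      "page {z, w} = layer_page i {snd z, snd w}"
proof -
  obtain u1 u2 v1 v2 where e: "{z, w} = {(u1, u2), (v1, v2)}" and
    *: "(u1 = v1 \<and> u1 \<in> Inl ` verts (star n) \<and> {u2, v2} \<in> edges H) \<or>
      (u2 = v2 \<and> u2 \<in> verts H \<and> {u1, v1} \<in> edges (Q_graph (star n)))"
    using assms unfolding Q_sum_def graph.sel mem_Collect_eq by blast
  have zw: "z = (u1, u2) \<and> w = (v1, v2) \<or> z = (v1, v2) \<and> w = (u1, u2)"
    using e by (simp only: doubleton_eq_iff)
  from * show thesis
  proof
    assume 1: "u1 = v1 \<and> u1 \<in> Inl ` verts (star n) \<and> {u2, v2} \<in> edges H"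
    then obtain i where i: "u1 = Inl i" "i \<le> n"
      by (auto simp: verts_star)
    have "page {z, w} = layer_page i {u2, v2}"
      unfolding e using 1 i page_outer[OF H_edge(1), of u2 v2 i] by metis
    then show thesis
      using outer[of i] zw 1 i by (auto simp: insert_commute)
  next
    assume 2: "u2 = v2 \<and> u2 \<in> verts H \<and> {u1, v1} \<in> edges (Q_graph (star n))"
    then have le: "level_edge n (level u1) (level v1)"
      by (blast intro: level_edge_Q_graph)
    then have "u1 \<noteq> v1"
      by (auto simp: level_edge_def)
    then have "page {z, w} = level_page n (level u1) (level v1)"
      unfolding e using 2 page_inner by simp
    then show thesis
      using inner zw 2 le level_edge_commute level_page_commute by auto
  qed
qed

lemma Q_sum_edge_verts:
  assumes "{z, w} \<in> edges (Q_sum (star n) H)" "u \<in> {z, w}"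
  shows "fst u \<in> verts (star n) <+> edges (star n)" "snd u \<in> verts H"
proof -
  have "u \<in> verts (Q_sum (star n) H)"
    using fin_simple_graph_Q_sum[OF fin_simple_graph_star H] assms
    unfolding fin_simple_graph_def by blast
  then show "fst u \<in> verts (star n) <+> edges (star n)" "snd u \<in> verts H"
    by (auto simp: Q_sum_def)
qed

section \<open>Order of the blocks along the spine\<close>

lemma inj_posH: "u \<in> verts H \<Longrightarrow> v \<in> verts H \<Longrightarrow> posH u = posH v \<Longrightarrow> u = v"
  using embedding by (auto simp: matching_book_embedding_def inj_on_def)

lemma pos_bounds:
  assumes "level (fst z) \<le> 2 * n + 1"
  shows "(2 * n + 2) * posH (snd z) \<le> pos z" "pos z < (2 * n + 2) * Suc (posH (snd z))"
  using assms by (auto simp: pos_def)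

lemma pos_block_mono:
  assumes "level (fst z) \<le> 2 * n + 1" "level (fst w) \<le> 2 * n + 1" "pos z \<le> pos w"
  shows "posH (snd z) \<le> posH (snd w)"
proof -
  have "(2 * n + 2) * posH (snd z) < (2 * n + 2) * Suc (posH (snd w))"
    using pos_bounds[OF assms(1)] pos_bounds[OF assms(2)] assms(3) by linarith
  then show ?thesis
    by (simp only: mult_less_cancel1 less_Suc_eq_le)
qed

lemma pos_less_same_block:
  assumes "pos z < pos w" "snd w = snd z"
  shows "if snd z \<in> A then level (fst z) < level (fst w) else level (fst w) < level (fst z)"
  using assms by (auto simp: pos_def)

text \<open>An inner page is at most n, so a shared page must be the layer number i itself. The
  centre has the lowest level and cannot lie strictly between two others; for i > 0, no edge of
  colour i passes over leaf i.\<close>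

lemma inner_not_over_outer:
  assumes "level_edge n (level (fst z)) (level (fst w))" "fst u = Inl i"
    and "snd u = snd z" "snd w = snd z" "pos z < pos u" "pos u < pos w"
    and "level_page n (level (fst z)) (level (fst w)) = layer_page i f"
  shows False
proof -
  have "level_page n (level (fst z)) (level (fst w)) \<le> n"
    by (simp add: level_page_def)
  then have i: "level_page n (level (fst z)) (level (fst w)) = i"
    using assms(7) by (auto simp: layer_page_def split: if_splits)
  have lt: "level (fst z) < level (fst u) \<and> level (fst u) < level (fst w) \<or>
      level (fst w) < level (fst u) \<and> level (fst u) < level (fst z)"
    using pos_less_same_block[OF assms(5)] pos_less_same_block[OF assms(6)] assms(3,4)
    by (auto split: if_splits)
  show False
  proof (cases "i = 0")
    case True
    then show False
      using lt assms(2) by (auto simp: level_centre)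
  next
    case False
    then have "level (fst u) = 2 * i + 1"
      using assms(2) by (simp add: level_leaf)
    then show False
      using lt i assms(1) level_edges_not_over_leaf[of n "level (fst z)" "level (fst w)" i]
        level_edges_not_over_leaf[of n "level (fst w)" "level (fst z)" i]
      by (auto simp: level_edge_commute level_page_commute)
  qed
qed

section \<open>Verification of the embedding\<close>

lemma pageH_eq_imp_edge_eq:
  assumes "e \<in> edges H" "f \<in> edges H" "v \<in> e" "v \<in> f" "pageH e = pageH f"
  shows "e = f"
proof -
  have "v \<in> verts H"
    using H assms(1,3) unfolding fin_simple_graph_def by blast
  then show ?thesis
    using embedding assms unfolding matching_book_embedding_def by blast
qed

lemma no_crossing_H:
  "e \<in> edges H \<Longrightarrow> f \<in> edges H \<Longrightarrow> pageH e = pageH f \<Longrightarrow> e \<noteq> f \<Longrightarrow> \<not> crossing posH e f"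
  using embedding by (simp add: matching_book_embedding_def)

text \<open>A value of at most n comes from page 0 of H; a larger one determines the page of H by
  subtracting n.\<close>

lemma layer_page_eq_imp_pageH_eq:
  assumes "layer_page i e = layer_page j f" "i \<le> n" "j \<le> n"
  shows "pageH e = pageH f"
  using assms by (auto simp: layer_page_def split: if_splits)

text \<open>The four ends lie in weakly ordered blocks. Two inner edges reduce to levels, and an
  inner edge would pass over an end of an outer one. Two outer edges are copies of one edge of H,
  hence nested, or would yield a crossing in H.\<close>

lemma no_crossing:
  assumes e: "{a, b} \<in> edges (Q_sum (star n) H)" and f: "{c, d} \<in> edges (Q_sum (star n) H)"
    and same_page: "page {a, b} = page {c, d}"
    and less: "pos a < pos c" "pos c < pos b" "pos b < pos d"
  shows False
proof -
  have vertex: "level (fst u) \<le> 2 * n + 1 \<and> snd u \<in> verts H" if "u \<in> {a, b, c, d}" for u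
  proof -
    from that consider "u \<in> {a, b}" | "u \<in> {c, d}"
      by blast
    then show ?thesis
    proof cases
      case 1
      from Q_sum_edge_verts[OF e this] show ?thesis
        using level_le by simp
    next
      case 2
      from Q_sum_edge_verts[OF f this] show ?thesis
        using level_le by simp
    qed
  qed
  have level: "level (fst a) \<le> 2 * n + 1" "level (fst b) \<le> 2 * n + 1"
      "level (fst c) \<le> 2 * n + 1" "level (fst d) \<le> 2 * n + 1"
    using vertex[of a] vertex[of b] vertex[of c] vertex[of d] by simp_all
  have block: "posH (snd a) \<le> posH (snd c)" "posH (snd c) \<le> posH (snd b)"
      "posH (snd b) \<le> posH (snd d)"
    using pos_block_mono[OF level(1,3)] pos_block_mono[OF level(3,2)] pos_block_mono[OF level(2,4)]
      less by simp_all
  have V: "snd a \<in> verts H" "snd b \<in> verts H" "snd c \<in> verts H" "snd d \<in> verts H"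
    using vertex[of a] vertex[of b] vertex[of c] vertex[of d] by simp_all
  from e show False
  proof (cases rule: Q_sum_edge_cases)
    case inner_e: inner
    \<comment> \<open>The ends \<open>a\<close> and \<open>b\<close> share a block, and
      \<open>c\<close> lies between them.\<close>
    have c: "snd c = snd a"
      using block inner_e(1) V by (auto intro: inj_posH)
    from f show False
    proof (cases rule: Q_sum_edge_cases)
      case inner_f: inner
      show False
      proof (cases "snd a \<in> A")
        case True
        then show False
          using level_edges_no_crossing[OF inner_e(2) inner_f(2)] same_page inner_e(3) inner_f(3)
            pos_less_same_block[OF less(1)] pos_less_same_block[OF less(2)]
            pos_less_same_block[OF less(3)] c inner_e(1) inner_f(1) by simp
      next
        case False
        \<comment> \<open>In a reversed block the levels increase along \<open>d\<close>,
          \<open>b\<close>, \<open>c\<close>, \<open>a\<close>, so the two edges swap roles.\<close>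
        then show False
          using level_edges_no_crossing[of n "level (fst d)" "level (fst c)" "level (fst b)"
              "level (fst a)"] same_page inner_e(2,3) inner_f(2,3)
            pos_less_same_block[OF less(1)] pos_less_same_block[OF less(2)]
            pos_less_same_block[OF less(3)] c inner_e(1) inner_f(1)
          by (simp add: level_edge_commute level_page_commute)
      qed
    next
      case outer_f: (outer i)
      show False
        using inner_not_over_outer[OF inner_e(2) outer_f(2) c inner_e(1) less(1,2)]
          same_page inner_e(3) outer_f(5) by metis
    qed
  next
    case outer_e: (outer i)
    from f show False
    proof (cases rule: Q_sum_edge_cases)
      case inner_f: inner
      have "snd b = snd c"
        using block inner_f(1) V by (auto intro: inj_posH)
      then show False
        using inner_not_over_outer[OF inner_f(2) outer_e(3) _ inner_f(1) less(2,3)]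
          same_page inner_f(3) outer_e(5) by metis
    next
      case outer_f: (outer j)
      have pageH: "pageH {snd a, snd b} = pageH {snd c, snd d}"
        using same_page outer_e(5) outer_f(5)
        by (intro layer_page_eq_imp_pageH_eq[OF _ outer_e(1) outer_f(1)]) simp
      show False
      proof (cases "{snd a, snd b} = {snd c, snd d}")
        case True
        \<comment> \<open>The opposite matching of ends would squeeze the blocks of \<open>a\<close>
          and \<open>b\<close> into one, although they are adjacent in H.\<close>
        have "snd a = snd c \<and> snd b = snd d"
        proof (rule ccontr)
          assume "\<not> (snd a = snd c \<and> snd b = snd d)"
          then have "snd a = snd d" "snd b = snd c"
            using True by (auto simp: doubleton_eq_iff)
          then show False
            using block(1,3) inj_posH[OF V(1,2)] H_edge(1)[OF outer_e(4)] by (metis le_antisym)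
        qed
        \<comment> \<open>The two blocks have opposite orientations, so the two layers would be
          ordered both ways.\<close>
        then show False
          using pos_less_same_block[OF less(1)] pos_less_same_block[OF less(3)]
            H_edge(4)[OF outer_e(4)] outer_e(2,3) outer_f(2,3) by (auto split: if_splits)
      next
        case False
        \<comment> \<open>Distinct edges of H on one page share no end, which makes the weak order
          of the blocks strict.\<close>
        have ne: "u \<noteq> v" if "u \<in> {snd a, snd b}" "v \<in> {snd c, snd d}" for u v
          using pageH_eq_imp_edge_eq[OF outer_e(4) outer_f(4) that(1) _ pageH] that False by blast
        then have "posH (snd a) < posH (snd c)" "posH (snd c) < posH (snd b)"
            "posH (snd b) < posH (snd d)"
          using block V inj_posH by (metis insertCI le_neq_implies_less)+
        then have "crossing posH {snd a, snd b} {snd c, snd d}"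
          unfolding crossing_def by blast
        then show False
          using no_crossing_H[OF outer_e(4) outer_f(4) pageH False] by simp
      qed
    qed
  qed
qed

text \<open>Two inner edges are separated by their colours, two outer ones by the matching condition
  in H. A mixed pair differs because an outer page is either above n or the layer number that is
  free at this vertex.\<close>

lemma matching_at_vertex:
  assumes e: "{u, w} \<in> edges (Q_sum (star n) H)" and f: "{u, z} \<in> edges (Q_sum (star n) H)"
    and same_page: "page {u, w} = page {u, z}"
  shows "w = z"
proof -
  have inner_outer: False
    if "level_edge n (level (fst u)) y" "fst u = Inl i" "i \<le> n"
      "level_page n (level (fst u)) y = layer_page i g" for y i g
  proof -
    have "level_page n (level (fst u)) y \<le> n"
      by (simp add: level_page_def)
    then show False
      using that level_page_ne_layer[of n i y] by (auto simp: layer_page_def split: if_splits)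
  qed
  from e show ?thesis
  proof (cases rule: Q_sum_edge_cases)
    case inner_e: inner
    from f show ?thesis
    proof (cases rule: Q_sum_edge_cases)
      case inner_f: inner
      have "level (fst w) = level (fst z)"
        using level_edges_matching[OF inner_e(2) inner_f(2)] same_page inner_e(3) inner_f(3) by simp
      then have "fst w = fst z"
        using inj_onD[OF inj_on_level _ Q_sum_edge_verts(1)[OF e] Q_sum_edge_verts(1)[OF f]]
        by simp
      then show ?thesis
        using inner_e(1) inner_f(1) by (simp add: prod_eq_iff)
    next
      case (outer i)
      then show ?thesis
        using inner_outer[OF inner_e(2) outer(2,1)] same_page inner_e(3) by metis
    qed
  next
    case outer_e: (outer i)
    from f show ?thesis
    proof (cases rule: Q_sum_edge_cases)
      case inner
      then show ?thesis
        using inner_outer[OF inner(2) outer_e(2,1)] same_page outer_e(5) by metis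
    next
      case outer_f: (outer j)
      have "pageH {snd u, snd w} = pageH {snd u, snd z}"
        using same_page outer_e(5) outer_f(5)
        by (intro layer_page_eq_imp_pageH_eq[OF _ outer_e(1) outer_f(1)]) simp
      then have "{snd u, snd w} = {snd u, snd z}"
        using pageH_eq_imp_edge_eq[OF outer_e(4) outer_f(4), of "snd u"] by simp
      then have "snd w = snd z"
        by (auto simp: doubleton_eq_iff)
      then show ?thesis
        using outer_e(2,3) outer_f(2,3) by (simp add: prod_eq_iff)
    qed
  qed
qed

text \<open>The \<open>max 1\<close> accounts for k = 0, where the blocks still use n + 1
  colours.\<close>

lemma page_less:
  assumes "{z, w} \<in> edges (Q_sum (star n) H)"
  shows "page {z, w} < n + max 1 k"
  using assms
proof (cases rule: Q_sum_edge_cases)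
  case inner
  have "level_page n (level (fst z)) (level (fst w)) < n + 1"
    by (simp add: level_page_def)
  then show ?thesis
    unfolding inner(3) by linarith
next
  case (outer i)
  have "pageH {snd z, snd w} < k"
    using embedding outer(4) by (simp add: matching_book_embedding_def)
  then show ?thesis
    unfolding outer(5) using outer(1) by (auto simp: layer_page_def)
qed

lemma inj_on_pos: "inj_on pos (verts (Q_sum (star n) H))"
proof (rule inj_onI)
  fix z w assume z: "z \<in> verts (Q_sum (star n) H)" and w: "w \<in> verts (Q_sum (star n) H)"
    and eq: "pos z = pos w"
  have Q: "fst z \<in> verts (star n) <+> edges (star n)" "fst w \<in> verts (star n) <+> edges (star n)"
      "snd z \<in> verts H" "snd w \<in> verts H"
    using z w by (auto simp: Q_sum_def)
  note le = level_le[OF Q(1)] level_le[OF Q(2)]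
  have "snd z = snd w"
    using pos_block_mono[OF le] pos_block_mono[OF le(2,1)] eq Q(3,4) by (auto intro: inj_posH)
  moreover from this have "level (fst z) = level (fst w)"
    using eq le by (auto simp: pos_def split: if_splits)
  then have "fst z = fst w"
    using inj_onD[OF inj_on_level _ Q(1,2)] by simp
  ultimately show "z = w"
    by (simp add: prod_eq_iff)
qed

lemma matching_book_embedding_Q_sum:
  "matching_book_embedding (Q_sum (star n) H) (n + max 1 k) pos page"
proof -
  have doubleton: "\<exists>z w. e = {z, w}" if "e \<in> edges (Q_sum (star n) H)" for e
    using that unfolding Q_sum_def by auto
  have "page e < n + max 1 k" if "e \<in> edges (Q_sum (star n) H)" for e
    using that doubleton[OF that] page_less by blast
  moreover have "\<not> crossing pos e f"
    if "e \<in> edges (Q_sum (star n) H)" "f \<in> edges (Q_sum (star n) H)" "page e = page f" for e f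
    unfolding crossing_def using no_crossing that by metis
  moreover have "e = f"
    if e: "e \<in> edges (Q_sum (star n) H)" and f: "f \<in> edges (Q_sum (star n) H)"
      and same_page: "page e = page f" and v: "v \<in> e" "v \<in> f" for e f v
  proof -
    obtain w z where "e = {v, w}" "f = {v, z}"
      using doubleton[OF e] doubleton[OF f] v by (auto simp: insert_commute)
    then show ?thesis
      using matching_at_vertex e f same_page by blast
  qed
  ultimately show ?thesis
    unfolding matching_book_embedding_def using inj_on_pos by blast
qed

end

section \<open>Vertices of large degree\<close>

lemma Q_graph_edge_vertex:
  "e \<in> edges G \<Longrightarrow> v \<in> e \<Longrightarrow> {Inl v, Inr e} \<in> edges (Q_graph G)"
  unfolding Q_graph_def graph.sel by blast

lemma Q_graph_edge_edge:
  "e \<in> edges G \<Longrightarrow> f \<in> edges G \<Longrightarrow> e \<noteq> f \<Longrightarrow> e \<inter> f \<noteq> {} \<Longrightarrow> {Inr e, Inr f} \<in> edges (Q_graph G)"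
  unfolding Q_graph_def graph.sel by blast

lemma Q_sum_star_inner_edge:
  assumes "v \<in> verts H" "{x, y} \<in> edges (Q_graph (star n))"
  shows "{(x, v), (y, v)} \<in> edges (Q_sum (star n) H)"
  using assms unfolding Q_sum_def by auto

text \<open>\<open>N1\<close> collects the subdivision vertices of the same block, \<open>N2\<close>
  the centres of the blocks over the neighbours of \<open>v\<close>.\<close>

lemma degree_centre_ge:
  assumes H: "fin_simple_graph H" and v: "v \<in> verts H"
  shows "n + degree H v \<le> degree (Q_sum (star n) H) (Inl 0, v)"
proof -
  define N1 where "N1 = (\<lambda>i. (Inr {0, i} :: nat + nat set, v)) ` {1..n}"
  define N2 where "N2 = (\<lambda>w. (Inl 0 :: nat + nat set, w)) ` {w. {v, w} \<in> edges H}"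
  have "{w. {v, w} \<in> edges H} \<subseteq> verts H"
    using H unfolding fin_simple_graph_def by blast
  then have fin: "finite {w. {v, w} \<in> edges H}"
    using H finite_subset unfolding fin_simple_graph_def by blast
  have "card N1 = n"
    unfolding N1_def by (subst card_image) (auto simp: inj_on_def doubleton_eq_iff)
  moreover have "card N2 = degree H v"
    unfolding N2_def degree_eq_neighbours[OF H] by (rule card_image) (auto simp: inj_on_def)
  moreover have "card (N1 \<union> N2) = card N1 + card N2"
    by (rule card_Un_disjoint) (auto simp: N1_def N2_def fin)
  moreover have "card (N1 \<union> N2) \<le> degree (Q_sum (star n) H) (Inl 0, v)"
  proof (rule neighbours_le_degree)
    show "finite (edges (Q_sum (star n) H))"
      by (rule finite_edges[OF fin_simple_graph_Q_sum[OF fin_simple_graph_star H]])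
    fix w assume "w \<in> N1 \<union> N2"
    then show "{(Inl 0, v), w} \<in> edges (Q_sum (star n) H)"
    proof
      assume "w \<in> N1"
      then obtain i where i: "w = (Inr {0, i}, v)" "i \<in> {1..n}"
        by (auto simp: N1_def)
      then have "{0, i} \<in> edges (star n)"
        by (auto simp: edges_star)
      then have "{Inl 0, Inr {0, i}} \<in> edges (Q_graph (star n))"
        by (rule Q_graph_edge_vertex) simp
      then show ?thesis
        unfolding i(1) by (rule Q_sum_star_inner_edge[OF v])
    next
      assume "w \<in> N2"
      then show ?thesis
        unfolding Q_sum_def N2_def graph.sel verts_star by fastforce
    qed
  qed
  ultimately show ?thesis
    by simp
qed

text \<open>This serves an edgeless H, where the bound at the centre gives only n. The neighbours
  are the n - 1 other subdivision vertices and the two ends of the subdivided edge.\<close>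

lemma degree_subdivision_vertex_ge:
  assumes H: "fin_simple_graph H" and v: "v \<in> verts H" and "1 \<le> n"
  shows "n + 1 \<le> degree (Q_sum (star n) H) (Inr {0, 1}, v)"
proof -
  define N1 where "N1 = (\<lambda>i. (Inr {0, i} :: nat + nat set, v)) ` {2..n}"
  define N2 where "N2 = {(Inl 0 :: nat + nat set, v), (Inl 1, v)}"
  have "card N1 = n - 1"
    unfolding N1_def by (subst card_image) (auto simp: inj_on_def doubleton_eq_iff)
  moreover have "card N2 = 2"
    unfolding N2_def by simp
  moreover have "card (N1 \<union> N2) = card N1 + card N2"
    by (rule card_Un_disjoint) (auto simp: N1_def N2_def)
  moreover have "card (N1 \<union> N2) \<le> degree (Q_sum (star n) H) (Inr {0, 1}, v)"
  proof (rule neighbours_le_degree)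
    show "finite (edges (Q_sum (star n) H))"
      by (rule finite_edges[OF fin_simple_graph_Q_sum[OF fin_simple_graph_star H]])
    fix w assume "w \<in> N1 \<union> N2"
    then obtain x where x: "w = (x, v)"
        "(\<exists>i\<in>{2..n}. x = Inr {0, i}) \<or> (\<exists>j\<in>{0, 1}. x = Inl j)"
      by (auto simp: N1_def N2_def)
    have first_edge: "{0, 1} \<in> edges (star n)"
      using \<open>1 \<le> n\<close> by (auto simp: edges_star)
    have "{Inr {0, 1}, x} \<in> edges (Q_graph (star n))"
      using x(2)
    proof
      assume "\<exists>i\<in>{2..n}. x = Inr {0, i}"
      then obtain i where i: "i \<in> {2..n}" "x = Inr {0, i}"
        by blast
      then have "{0, i} \<in> edges (star n)"
        by (auto simp: edges_star)
      then show ?thesis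
        unfolding i(2) using i(1)
        by (intro Q_graph_edge_edge[OF first_edge]) (auto simp: doubleton_eq_iff)
    next
      assume "\<exists>j\<in>{0, 1}. x = Inl j"
      then obtain j where "j \<in> {0, 1}" "x = Inl j"
        by blast
      then show ?thesis
        using Q_graph_edge_vertex[OF first_edge, of j] by (simp only: insert_commute)
    qed
    then show "{(Inr {0, 1}, v), w} \<in> edges (Q_sum (star n) H)"
      unfolding x(1) by (rule Q_sum_star_inner_edge[OF v])
  qed
  ultimately show ?thesis
    using \<open>1 \<le> n\<close> by simp
qed

lemma max_degree_Q_sum_star_ge:
  assumes H: "fin_simple_graph H" and ne: "verts H \<noteq> {}" and n: "1 \<le> n"
  shows "n + max 1 (max_degree H) \<le> max_degree (Q_sum (star n) H)"
proof -
  have "finite (verts H)"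
    using H by (simp add: fin_simple_graph_def)
  then obtain v where v: "v \<in> verts H" "degree H v = max_degree H"
    using ne by (rule max_degree_attained)
  have "finite (verts (Q_sum (star n) H))"
    using fin_simple_graph_Q_sum[OF fin_simple_graph_star H] by (simp add: fin_simple_graph_def)
  note le = degree_le_max_degree[OF this]
  have "(Inl 0, v) \<in> verts (Q_sum (star n) H)" "(Inr {0, 1}, v) \<in> verts (Q_sum (star n) H)"
    using v(1) n by (auto simp: Q_sum_def verts_star edges_star)
  from this[THEN le] show ?thesis
    using degree_centre_ge[OF H v(1), of n] degree_subdivision_vertex_ge[OF H v(1) n] v(2) by simp
qed

theorem theorem3p3:
  fixes n :: nat and H :: "'b graph"
  assumes "n \<ge> 1"
    and "fin_simple_graph H"
    and "bipartite H"
    and "dispersable H"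
  shows "dispersable (Q_sum (star n) H)"
proof (cases "verts H = {}")
  case True
  \<comment> \<open>Here the sum is empty and has maximum degree 0, so the general count of pages
    would be too large; 0 pages suffice.\<close>
  have simple: "fin_simple_graph (Q_sum (star n) H)"
    by (rule fin_simple_graph_Q_sum[OF fin_simple_graph_star assms(2)])
  moreover have verts: "verts (Q_sum (star n) H) = {}"
    using True by (simp add: Q_sum_def)
  moreover have "edges (Q_sum (star n) H) = {}"
    using simple verts by (auto simp: fin_simple_graph_def)
  ultimately show ?thesis
    by (intro dispersableI[where k = 0]) (auto simp: matching_book_embedding_def)
next
  case False
  \<comment> \<open>Dispersability makes the number of pages of H its maximum degree, the quantity
    that the degree bound supplies.\<close>
  obtain posH pageH where emb: "matching_book_embedding H (max_degree H) posH pageH"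
    using mbt_attained[OF assms(2)] assms(4) unfolding dispersable_def by metis
  obtain A B where "A \<inter> B = {}" "\<forall>e\<in>edges H. \<exists>a\<in>A. \<exists>b\<in>B. e = {a, b}"
    using assms(3) unfolding bipartite_def by blast
  then interpret bipartite_embedding n "max_degree H" H A B posH pageH
    using assms(2) emb by unfold_locales blast+
  show ?thesis
    using fin_simple_graph_Q_sum[OF fin_simple_graph_star assms(2)] matching_book_embedding_Q_sum
      max_degree_Q_sum_star_ge[OF assms(2) False assms(1)]
    by (rule dispersableI)
qed

end
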